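(* Fix a policy $g:\mathcal{X}\to[J]$ and let $\widehat{\tau}(g)$ be the minimizer of $$\min_{\tau\in[0,1/\eta]}\ \left(\frac1N\sum_{s=1}^N \mathbf{1}\left\{\frac{1}{e(X^s,g(X^s))}>\tau\right\}\right)^2+\frac{2}{N^2}\sum_{s=1}^N\frac{\mathbf{1}\{g(X^s)=D_s\}}{e(X^s,g(X^s))^2}\,\mathbf{1}\left\{\frac{1}{e(X^s,g(X^s))}\le\tau\right\}.$$ Suppose that the sum over any (nonempty) subset of $\{2(C_s)^2\}_{s=1}^N$ is not an integer, where $C_s=1/e(X^s,g(X^s))$. Let $$m^*=\min\{m\in[N]:\ 2(C_{(m)})^2\ge 2(N-m)+1\}.$$ Then $$\widehat{\tau}(g)=\sum_{m=m^*-1}^N C_{(m)}\cdot \mathbf{1}_{(0,\infty)}\left(\min_{m^*\le t\le N+1,\ t\neq m+1}\Phi_t(g)-\Phi_{m+1}(g)\right).$$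
   Context: $[n]=\{1,\dots,n\}$. The data are $(X^s,D_s)$, $s=1,\dots,N$, with covariates $X^s\in\mathcal{X}\subseteq\mathbb{R}^p$ and treatments $D_s\in[J]$; $e(\xi,j)$ is the known propensity score, i.e. the probability that treatment $j$ is chosen given covariate $\xi$, and $e(\xi,j)\ge\eta>0$ for all $\xi\in\mathcal{X}$, $j\in[J]$. For the given policy $g$, let $C_s=1/e(X^s,g(X^s))$, and sort the samples so that $0=C_{(0)}\le C_{(1)}\le\dots\le C_{(N)}$, where $C_{(0)}=0$ is added by convention and $(X^{(s)},D_{(s)})$ is the sample with the $s$-th smallest value $C_{(s)}$. Let $\varphi_{(s)}(g)=(C_{(s)})^2\,\mathbf{1}\{g(X^{(s)})=D_{(s)}\}$, let $\Phi_m(g)=\sum_{s=m}^N\big(2(N-s)+1-2\varphi_{(s)}(g)\big)$ for $m=1,\dots,N$, and $\Phi_{N+1}(g)=0$. The objective is piecewise constant in $\tau$ with jumps only at the values $C_{(s)}$; "the minimizer" $\widehat\tau(g)$ means the minimizer taken among the values $C_{(0)},\dots,C_{(N)}$. $\mathbf{1}_{(0,\infty)}(t)=1$ if $t>0$ and $0$ otherwise; a minimum over the empty set is $+\infty$.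
   Formalization: The values C_1,…,C_N are additionally assumed pairwise distinct; with ties the claim is false, e.g. N=2, both samples with g(X^s)=D_s, C_1=C_2=1.1: the minimizer is 0 but the formula gives 1.1. *)

theory Defs
  imports "HOL-Analysis.Analysis"
begin

text \<open>
  Treatments are the natural numbers in \<open>{1..J}\<close>; the samples are
  \<open>(X s, D s)\<close> for \<open>s \<in> {1..N}\<close>, and \<open>e \<xi> j\<close> is the propensity score. Values of \<open>X\<close>, \<open>D\<close>
  outside \<open>{1..N}\<close> are never used.
\<close>

definition inv_prop :: "('x \<Rightarrow> nat \<Rightarrow> real) \<Rightarrow> ('x \<Rightarrow> nat) \<Rightarrow> (nat \<Rightarrow> 'x) \<Rightarrow> nat \<Rightarrow> real" where
  "inv_prop e g X s = 1 / e (X s) (g (X s))"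

definition trunc_objective ::
  "nat \<Rightarrow> ('x \<Rightarrow> nat \<Rightarrow> real) \<Rightarrow> ('x \<Rightarrow> nat) \<Rightarrow> (nat \<Rightarrow> 'x) \<Rightarrow> (nat \<Rightarrow> nat) \<Rightarrow> real \<Rightarrow> real" where
  "trunc_objective N e g X D \<tau> =
     (1 / real N * (\<Sum>s=1..N. of_bool (1 / e (X s) (g (X s)) > \<tau>)))\<^sup>2
     + 2 / (real N)\<^sup>2 *
       (\<Sum>s=1..N. of_bool (g (X s) = D s) / (e (X s) (g (X s)))\<^sup>2
                  * of_bool (1 / e (X s) (g (X s)) \<le> \<tau>))"

text \<open>
  A sorting of the samples is a permutation \<open>\<sigma>\<close> of \<open>{1..N}\<close>: the sample with the \<open>s\<close>-th smallest
  value of \<open>inv_prop\<close> has index \<open>\<sigma> s\<close>. It is unique when \<open>inv_prop\<close> has no ties. With ties,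
  \<open>Phi\<close> below can be minimal at an index inside a block of equal values, where it does not
  correspond to any value of the objective.
\<close>

definition is_sorting ::
  "nat \<Rightarrow> ('x \<Rightarrow> nat \<Rightarrow> real) \<Rightarrow> ('x \<Rightarrow> nat) \<Rightarrow> (nat \<Rightarrow> 'x) \<Rightarrow> (nat \<Rightarrow> nat) \<Rightarrow> bool" where
  "is_sorting N e g X \<sigma> \<longleftrightarrow>
     bij_betw \<sigma> {1..N} {1..N} \<and> mono_on {1..N} (\<lambda>s. inv_prop e g X (\<sigma> s))"

definition C_ord ::
  "('x \<Rightarrow> nat \<Rightarrow> real) \<Rightarrow> ('x \<Rightarrow> nat) \<Rightarrow> (nat \<Rightarrow> 'x) \<Rightarrow> (nat \<Rightarrow> nat) \<Rightarrow> nat \<Rightarrow> real" where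
  "C_ord e g X \<sigma> s = (if s = 0 then 0 else inv_prop e g X (\<sigma> s))"

definition phi_ord ::
  "('x \<Rightarrow> nat \<Rightarrow> real) \<Rightarrow> ('x \<Rightarrow> nat) \<Rightarrow> (nat \<Rightarrow> 'x) \<Rightarrow> (nat \<Rightarrow> nat) \<Rightarrow> (nat \<Rightarrow> nat) \<Rightarrow> nat \<Rightarrow> real" where
  "phi_ord e g X D \<sigma> s = (C_ord e g X \<sigma> s)\<^sup>2 * of_bool (g (X (\<sigma> s)) = D (\<sigma> s))"

text \<open>At \<open>m = N + 1\<close> the sum is empty, which gives the convention \<open>Phi \<dots> (N + 1) = 0\<close>.\<close>

definition Phi ::
  "nat \<Rightarrow> ('x \<Rightarrow> nat \<Rightarrow> real) \<Rightarrow> ('x \<Rightarrow> nat) \<Rightarrow> (nat \<Rightarrow> 'x) \<Rightarrow> (nat \<Rightarrow> nat) \<Rightarrow> (nat \<Rightarrow> nat) \<Rightarrow> nat \<Rightarrow> real" where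
  "Phi N e g X D \<sigma> m =
     (\<Sum>s=m..N. 2 * (real N - real s) + 1 - 2 * phi_ord e g X D \<sigma> s)"

text \<open>
  The set below contains \<open>N\<close> whenever \<open>N \<ge> 1\<close> and all propensities lie in \<open>(0, 1]\<close>, because then
  \<open>C_ord \<dots> N \<ge> 1\<close>; so \<open>Min\<close> is never applied to the empty set.
\<close>

definition m_star ::
  "nat \<Rightarrow> ('x \<Rightarrow> nat \<Rightarrow> real) \<Rightarrow> ('x \<Rightarrow> nat) \<Rightarrow> (nat \<Rightarrow> 'x) \<Rightarrow> (nat \<Rightarrow> nat) \<Rightarrow> nat" where
  "m_star N e g X \<sigma> =
     Min {m \<in> {1..N}. 2 * (C_ord e g X \<sigma> m)\<^sup>2 \<ge> 2 * (real N - real m) + 1}"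

text \<open>
  The objective is piecewise constant in \<open>\<tau>\<close>, so its minimizers over \<open>[0, 1/\<eta>]\<close> form intervals;
  the minimizer meant is the one among \<open>0\<close> and the values of \<open>inv_prop\<close>, at which it jumps.
\<close>

definition is_tau_hat ::
  "nat \<Rightarrow> real \<Rightarrow> ('x \<Rightarrow> nat \<Rightarrow> real) \<Rightarrow> ('x \<Rightarrow> nat) \<Rightarrow> (nat \<Rightarrow> 'x) \<Rightarrow> (nat \<Rightarrow> nat)
    \<Rightarrow> real \<Rightarrow> bool" where
  "is_tau_hat N \<eta> e g X D \<tau> \<longleftrightarrow>
     \<tau> \<in> insert 0 (inv_prop e g X ` {1..N}) \<and>
     is_arg_min (trunc_objective N e g X D) (\<lambda>t. t \<in> {0..1 / \<eta>}) \<tau>"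

definition tau_hat ::
  "nat \<Rightarrow> real \<Rightarrow> ('x \<Rightarrow> nat \<Rightarrow> real) \<Rightarrow> ('x \<Rightarrow> nat) \<Rightarrow> (nat \<Rightarrow> 'x) \<Rightarrow> (nat \<Rightarrow> nat)
    \<Rightarrow> real" where
  "tau_hat N \<eta> e g X D = (THE \<tau>. is_tau_hat N \<eta> e g X D \<tau>)"

end

theory Submission
  imports Defs
begin

text \<open>
  Write \<open>c s = C_ord e g X \<sigma> s\<close>. With \<open>0 = c 0 < c 1 < \<dots> < c N\<close>, every \<open>\<tau> \<ge> 0\<close> truncates exactly the
  sorted samples after some index \<open>k\<close>. Because \<open>(N - k)\<^sup>2\<close> is the sum of the odd numbers
  \<open>2 (N - s) + 1\<close> over \<open>k < s \<le> N\<close>, the objective at such a \<open>\<tau>\<close> equals, up to the factor \<open>1 / N\<^sup>2\<close>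
  and a constant independent of \<open>k\<close>, the tail sum \<open>Phi (k + 1)\<close>
  (\<open>trunc_objective_eq_Phi\<close>). So the problem is to minimize \<open>Phi\<close> over \<open>{1..N + 1}\<close>, and
  \<open>c k\<close> is a minimizer of the objective precisely when \<open>k + 1\<close> is one of \<open>Phi\<close>.

  The minimizer of \<open>Phi\<close> is unique because \<open>Phi\<close> is injective (\<open>inj_on_Phi\<close>): a difference of two
  values is an integer minus a sum of \<open>2 (C s)\<^sup>2\<close> over some set of samples. If that set is nonempty the
  difference is not an integer; if it is empty the difference is a nonempty sum of positive odd
  numbers. Moreover the summand at each \<open>m < m*\<close> is positive, whether or not sample \<open>m\<close>
  contributes its square, so \<open>Phi\<close> strictly decreases up to \<open>m*\<close> (\<open>Phi_m_star_less\<close>) and the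
  minimizer lies in \<open>{m*..N + 1}\<close>. In the formula for the minimizer, the
  indicator tests whether \<open>Phi (m + 1)\<close> is strictly below all other values of \<open>Phi\<close> on that range,
  which holds for exactly one \<open>m\<close>, so the sum has a single nonzero coefficient.
\<close>

section \<open>Thresholds and the objective\<close>

lemma sum_odd_eq_square:
  assumes "k \<le> N"
  shows "(\<Sum>s=k+1..N. 2 * (real N - real s) + 1) = (real N - real k)\<^sup>2"
  using assms
proof (induction k rule: inc_induct)
  case base
  then show ?case by simp
next
  case (step k)
  then have "(\<Sum>s=k+1..N. 2 * (real N - real s) + 1)
      = 2 * (real N - real (k+1)) + 1 + (\<Sum>s=Suc k+1..N. 2 * (real N - real s) + 1)"
    by (subst sum.atLeast_Suc_atMost) auto
  with step show ?case by (simp add: power2_eq_square algebra_simps)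
qed

text \<open>
  The hypothesis on \<open>\<tau>\<close> says that the samples kept at level \<open>\<tau>\<close> are the first \<open>k\<close> in sorted order.
\<close>

lemma trunc_objective_eq_Phi:
  assumes sorting: "is_sorting N e g X \<sigma>" and k: "k \<le> N"
    and thr: "\<And>s. s \<in> {1..N} \<Longrightarrow> C_ord e g X \<sigma> s \<le> \<tau> \<longleftrightarrow> s \<le> k"
  shows "trunc_objective N e g X D \<tau> =
    (Phi N e g X D \<sigma> (k + 1) + 2 * (\<Sum>s=1..N. phi_ord e g X D \<sigma> s)) / (real N)\<^sup>2"
proof -
  let ?phi = "phi_ord e g X D \<sigma>"
  have bij: "bij_betw \<sigma> {1..N} {1..N}" using sorting by (simp add: is_sorting_def)
  have inv: "1 / e (X (\<sigma> s)) (g (X (\<sigma> s))) = C_ord e g X \<sigma> s" if "s \<in> {1..N}" for s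
    using that by (simp add: C_ord_def inv_prop_def)
  have "(\<Sum>s=1..N. of_bool (1 / e (X s) (g (X s)) > \<tau>) :: real)
      = (\<Sum>s=1..N. of_bool (1 / e (X (\<sigma> s)) (g (X (\<sigma> s))) > \<tau>))"
    by (rule sum.reindex_bij_betw[OF bij, symmetric])
  also have "\<dots> = (\<Sum>s=1..N. if s \<in> {k+1..N} then 1 else 0)"
    by (rule sum.cong) (use inv thr in \<open>auto simp: not_le[symmetric] simp del: not_le\<close>)
  also have "\<dots> = real N - real k"
    using k sum.inter_restrict[of "{1..N}" "\<lambda>_. 1 :: real" "{k+1..N}"]
    by (simp add: Int_absorb1 of_nat_diff)
  finally have A: "(\<Sum>s=1..N. of_bool (1 / e (X s) (g (X s)) > \<tau>) :: real) = real N - real k" .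
  have "(\<Sum>s=1..N. of_bool (g (X s) = D s) / (e (X s) (g (X s)))\<^sup>2
                  * of_bool (1 / e (X s) (g (X s)) \<le> \<tau>) :: real)
      = (\<Sum>s=1..N. of_bool (g (X (\<sigma> s)) = D (\<sigma> s)) / (e (X (\<sigma> s)) (g (X (\<sigma> s))))\<^sup>2
                  * of_bool (1 / e (X (\<sigma> s)) (g (X (\<sigma> s))) \<le> \<tau>))"
    by (rule sum.reindex_bij_betw[OF bij, symmetric])
  also have "\<dots> = (\<Sum>s=1..N. if s \<in> {1..k} then ?phi s else 0)"
    by (rule sum.cong)
      (use inv thr in \<open>auto simp: phi_ord_def C_ord_def inv_prop_def power_one_over\<close>)
  also have "\<dots> = sum ?phi {1..k}"
    using k sum.inter_restrict[of "{1..N}" ?phi "{1..k}"] by (simp add: Int_absorb1)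
  finally have B: "(\<Sum>s=1..N. of_bool (g (X s) = D s) / (e (X s) (g (X s)))\<^sup>2
                  * of_bool (1 / e (X s) (g (X s)) \<le> \<tau>) :: real) = sum ?phi {1..k}" .
  have split: "sum ?phi {1..N} = sum ?phi {1..k} + sum ?phi {k+1..N}"
    using k by (subst sum.union_disjoint[symmetric]) (auto intro: sum.cong)
  have "Phi N e g X D \<sigma> (k + 1) = (real N - real k)\<^sup>2 - 2 * sum ?phi {k+1..N}"
    unfolding Phi_def using sum_odd_eq_square[OF k]
    by (simp add: sum_subtractf sum_distrib_left)
  with split have "Phi N e g X D \<sigma> (k + 1) + 2 * sum ?phi {1..N}
      = (real N - real k)\<^sup>2 + 2 * sum ?phi {1..k}"
    by linarith
  then show ?thesis
    unfolding trunc_objective_def A B by (simp add: add_divide_distrib power_divide)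
qed

lemma C_ord_strict_mono:
  assumes sorting: "is_sorting N e g X \<sigma>" and no_ties: "inj_on (inv_prop e g X) {1..N}"
    and pos: "\<And>s. s \<in> {1..N} \<Longrightarrow> inv_prop e g X s > 0"
  shows "strict_mono_on {0..N} (C_ord e g X \<sigma>)"
proof (rule strict_mono_onI)
  fix r s assume rs: "r \<in> {0..N}" "s \<in> {0..N}" "r < s"
  have bij: "bij_betw \<sigma> {1..N} {1..N}" using sorting by (simp add: is_sorting_def)
  then have mem: "\<sigma> i \<in> {1..N}" if "i \<in> {1..N}" for i
    using that by (rule bij_betwE[rule_format])
  show "C_ord e g X \<sigma> r < C_ord e g X \<sigma> s"
  proof (cases "r = 0")
    case True
    then show ?thesis using rs pos[OF mem[of s]] by (simp add: C_ord_def)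
  next
    case False
    then have in_range: "r \<in> {1..N}" "s \<in> {1..N}" using rs by auto
    have "inv_prop e g X (\<sigma> r) \<le> inv_prop e g X (\<sigma> s)"
      using sorting in_range rs(3) by (auto simp: is_sorting_def mono_on_def)
    moreover have "\<sigma> r \<noteq> \<sigma> s"
      using bij in_range rs(3) by (auto simp: bij_betw_def dest: inj_onD)
    then have "inv_prop e g X (\<sigma> r) \<noteq> inv_prop e g X (\<sigma> s)"
      using no_ties mem in_range by (auto dest: inj_onD)
    ultimately show ?thesis using False rs by (simp add: C_ord_def)
  qed
qed

text \<open>
  This reduces the minimization over all real levels to the jump points: \<open>\<tau>\<close> truncates the same
  samples as the largest jump point that is at most \<open>\<tau>\<close>, where \<open>0\<close> serves as the jump point of
  index \<open>0\<close>.
\<close>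

lemma threshold_index_exists:
  assumes mono: "strict_mono_on {0..N} (C_ord e g X \<sigma>)" and "0 \<le> \<tau>"
  shows "\<exists>k\<le>N. \<forall>s\<in>{1..N}. C_ord e g X \<sigma> s \<le> \<tau> \<longleftrightarrow> s \<le> k"
proof -
  define K where "K = {s \<in> {0..N}. C_ord e g X \<sigma> s \<le> \<tau>}"
  have fin: "finite K" and "0 \<in> K"
    using assms(2) by (auto simp: K_def C_ord_def)
  then have max: "Max K \<in> K" by (intro Max_in) auto
  have "C_ord e g X \<sigma> s \<le> \<tau> \<longleftrightarrow> s \<le> Max K" if s: "s \<in> {1..N}" for s
  proof
    assume "C_ord e g X \<sigma> s \<le> \<tau>"
    then show "s \<le> Max K" using s fin by (auto simp: K_def intro: Max_ge)
  next
    assume "s \<le> Max K"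
    then have "C_ord e g X \<sigma> s \<le> C_ord e g X \<sigma> (Max K)"
      using s max strict_mono_on_leD[OF mono] by (auto simp: K_def)
    then show "C_ord e g X \<sigma> s \<le> \<tau>" using max by (simp add: K_def)
  qed
  with max show ?thesis by (auto simp: K_def)
qed

section \<open>The tail sums\<close>

lemma Phi_diff:
  assumes "t \<le> u" "u \<le> N + 1"
  shows "Phi N e g X D \<sigma> t - Phi N e g X D \<sigma> u =
    (\<Sum>s=t..<u. 2 * (real N - real s) + 1 - 2 * phi_ord e g X D \<sigma> s)"
proof -
  have "{t..N} = {t..<u} \<union> {u..N}" using assms by auto
  then show ?thesis unfolding Phi_def by (simp add: sum.union_disjoint ivl_disj_int)
qed

lemma Phi_neq:
  assumes bij: "bij_betw \<sigma> {1..N} {1..N}"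
    and non_integer: "\<And>S. S \<subseteq> {1..N} \<Longrightarrow> S \<noteq> {} \<Longrightarrow> (\<Sum>s\<in>S. 2 * (inv_prop e g X s)\<^sup>2) \<notin> \<int>"
    and t: "1 \<le> t" "t < u" "u \<le> N + 1"
  shows "Phi N e g X D \<sigma> t \<noteq> Phi N e g X D \<sigma> u"
proof
  assume eq: "Phi N e g X D \<sigma> t = Phi N e g X D \<sigma> u"
  \<comment> \<open>the samples whose squares enter the difference\<close>
  define M where "M = {s \<in> {t..<u}. g (X (\<sigma> s)) = D (\<sigma> s)}"
  have sub: "M \<subseteq> {1..N}" using t by (auto simp: M_def)
  have "(\<Sum>s=t..<u. 2 * phi_ord e g X D \<sigma> s)
      = (\<Sum>s=t..<u. if g (X (\<sigma> s)) = D (\<sigma> s) then 2 * (inv_prop e g X (\<sigma> s))\<^sup>2 else 0)"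
    by (rule sum.cong) (use t in \<open>auto simp: phi_ord_def C_ord_def\<close>)
  also have "\<dots> = (\<Sum>s\<in>M. 2 * (inv_prop e g X (\<sigma> s))\<^sup>2)"
    unfolding M_def by (rule sum.inter_filter[symmetric]) simp
  also have "\<dots> = (\<Sum>s\<in>\<sigma> ` M. 2 * (inv_prop e g X s)\<^sup>2)"
    using bij sub by (subst sum.reindex) (auto simp: bij_betw_def intro: inj_on_subset)
  finally have squares: "(\<Sum>s=t..<u. 2 * phi_ord e g X D \<sigma> s)
      = (\<Sum>s\<in>\<sigma> ` M. 2 * (inv_prop e g X s)\<^sup>2)" .
  have odd: "(\<Sum>s=t..<u. 2 * (real N - real s) + 1) = (\<Sum>s\<in>\<sigma> ` M. 2 * (inv_prop e g X s)\<^sup>2)"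
    using eq Phi_diff[of t u N e g X D \<sigma>] t squares by (simp add: sum_subtractf)
  show False
  proof (cases "M = {}")
    case True
    have "(\<Sum>s=t..<u. 2 * (real N - real s) + 1) > 0"
      using t by (intro sum_pos) auto
    then show False using odd True by simp
  next
    case False
    have "(\<Sum>s=t..<u. 2 * (real N - real s) + 1) \<in> \<int>" by (intro Ints_sum) auto
    moreover have "\<sigma> ` M \<subseteq> {1..N}" using bij sub by (auto simp: bij_betw_def)
    ultimately show False using non_integer[of "\<sigma> ` M"] False odd by simp
  qed
qed

lemma inj_on_Phi:
  assumes "bij_betw \<sigma> {1..N} {1..N}"
    and "\<And>S. S \<subseteq> {1..N} \<Longrightarrow> S \<noteq> {} \<Longrightarrow> (\<Sum>s\<in>S. 2 * (inv_prop e g X s)\<^sup>2) \<notin> \<int>"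
  shows "inj_on (Phi N e g X D \<sigma>) {1..N + 1}"
proof (rule linorder_inj_onI)
  fix t u assume "t < u" "t \<in> {1..N + 1}" "u \<in> {1..N + 1}"
  then show "Phi N e g X D \<sigma> t \<noteq> Phi N e g X D \<sigma> u"
    using Phi_neq[of \<sigma> N e g X t u D] assms by auto
qed auto

lemma m_star_in_range:
  assumes "N \<ge> 1" "C_ord e g X \<sigma> N \<ge> 1"
  shows "m_star N e g X \<sigma> \<in> {1..N}"
proof -
  have "1 \<le> (C_ord e g X \<sigma> N)\<^sup>2" using assms(2) by (rule one_le_power)
  then have "Min {m \<in> {1..N}. 2 * (C_ord e g X \<sigma> m)\<^sup>2 \<ge> 2 * (real N - real m) + 1}
      \<in> {m \<in> {1..N}. 2 * (C_ord e g X \<sigma> m)\<^sup>2 \<ge> 2 * (real N - real m) + 1}" (is "Min ?S \<in> ?S")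
    using assms(1) by (intro Min_in) (auto intro!: exI[of _ N])
  then show ?thesis unfolding m_star_def by blast
qed

text \<open>
  By minimality of \<open>m*\<close>, every summand before it stays positive even when its square is subtracted.
\<close>

lemma Phi_m_star_less:
  assumes t: "1 \<le> t" "t < m_star N e g X \<sigma>" and range: "m_star N e g X \<sigma> \<le> N"
  shows "Phi N e g X D \<sigma> (m_star N e g X \<sigma>) < Phi N e g X D \<sigma> t"
proof -
  have "2 * (real N - real s) + 1 - 2 * phi_ord e g X D \<sigma> s > 0"
    if s: "s \<in> {t..<m_star N e g X \<sigma>}" for s
  proof -
    have "\<not> 2 * (C_ord e g X \<sigma> s)\<^sup>2 \<ge> 2 * (real N - real s) + 1"
    proof
      assume "2 * (C_ord e g X \<sigma> s)\<^sup>2 \<ge> 2 * (real N - real s) + 1"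
      then have "m_star N e g X \<sigma> \<le> s"
        unfolding m_star_def using s t range by (intro Min_le) auto
      then show False using s by simp
    qed
    moreover have "phi_ord e g X D \<sigma> s \<le> (C_ord e g X \<sigma> s)\<^sup>2" by (simp add: phi_ord_def)
    ultimately show ?thesis by linarith
  qed
  then have "(\<Sum>s=t..<m_star N e g X \<sigma>. 2 * (real N - real s) + 1 - 2 * phi_ord e g X D \<sigma> s) > 0"
    using t by (intro sum_pos) auto
  then show ?thesis
    using Phi_diff[of t "m_star N e g X \<sigma>" N e g X D \<sigma>] t range by simp
qed

section \<open>The formula for the minimizer\<close>

text \<open>
  A second index in the range is needed, since otherwise the minimum would be over the empty set.
\<close>

lemma indicator_strict_minimum:
  fixes f :: "'i \<Rightarrow> real"
  assumes "finite T" and k: "k \<in> T" and t: "t \<in> T" and other: "T - {t} \<noteq> {}"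
    and strict: "\<And>u. u \<in> T \<Longrightarrow> u \<noteq> k \<Longrightarrow> f k < f u"
  shows "indicator {0<..} ((MIN u \<in> T - {t}. f u) - f t) = (of_bool (t = k) :: real)"
proof -
  have iff: "(MIN u \<in> T - {t}. f u) > f t \<longleftrightarrow> (\<forall>u\<in>T - {t}. f u > f t)"
    using assms(1) other by (subst Min_gr_iff) auto
  also have "\<dots> \<longleftrightarrow> t = k"
  proof
    assume least: "\<forall>u\<in>T - {t}. f u > f t"
    show "t = k"
    proof (rule ccontr)
      assume "t \<noteq> k"
      then have "f t < f k" "f k < f t" using least k strict[OF t] by auto
      then show False by simp
    qed
  qed (use strict in auto)
  finally show ?thesis by (simp add: indicator_def)
qed

theorem proposition5:
  fixes N J :: nat
    and \<X> :: "(real ^ 'p) set"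
    and X :: "nat \<Rightarrow> real ^ 'p" and D :: "nat \<Rightarrow> nat"
    and e :: "real ^ 'p \<Rightarrow> nat \<Rightarrow> real" and \<eta> :: real
    and g :: "real ^ 'p \<Rightarrow> nat" and \<sigma> :: "nat \<Rightarrow> nat"
  assumes N: "N \<ge> 1"
    and X: "\<And>s. s \<in> {1..N} \<Longrightarrow> X s \<in> \<X>"
    and D: "\<And>s. s \<in> {1..N} \<Longrightarrow> D s \<in> {1..J}"
    and e_prob: "\<And>\<xi>. \<xi> \<in> \<X> \<Longrightarrow> (\<Sum>j=1..J. e \<xi> j) = 1"
    and eta: "\<eta> > 0"
    and overlap: "\<And>\<xi> j. \<xi> \<in> \<X> \<Longrightarrow> j \<in> {1..J} \<Longrightarrow> e \<xi> j \<ge> \<eta>"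
    and g: "\<And>\<xi>. \<xi> \<in> \<X> \<Longrightarrow> g \<xi> \<in> {1..J}"
    and sorting: "is_sorting N e g X \<sigma>"
    and no_ties: "inj_on (inv_prop e g X) {1..N}"
    and non_integer: "\<And>S. S \<subseteq> {1..N} \<Longrightarrow> S \<noteq> {} \<Longrightarrow> (\<Sum>s\<in>S. 2 * (inv_prop e g X s)\<^sup>2) \<notin> \<int>"
  shows "(\<exists>!\<tau>. is_tau_hat N \<eta> e g X D \<tau>) \<and>
    tau_hat N \<eta> e g X D =
      (\<Sum>m = m_star N e g X \<sigma> - 1..N.
         C_ord e g X \<sigma> m *
         indicator {0<..}
           ((MIN t \<in> {m_star N e g X \<sigma>..N + 1} - {m + 1}. Phi N e g X D \<sigma> t)
             - Phi N e g X D \<sigma> (m + 1)))"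
proof -
  let ?C = "C_ord e g X \<sigma>" and ?P = "Phi N e g X D \<sigma>" and ?m = "m_star N e g X \<sigma>"
    and ?F = "trunc_objective N e g X D"
  have bij: "bij_betw \<sigma> {1..N} {1..N}" using sorting by (simp add: is_sorting_def)
  \<comment> \<open>propensities lie in \<open>[\<eta>, 1]\<close>, so their inverses lie in \<open>[1, 1/\<eta>]\<close>\<close>
  have inv_bounds: "1 \<le> inv_prop e g X s \<and> inv_prop e g X s \<le> 1 / \<eta>" if s: "s \<in> {1..N}" for s
  proof -
    have gs: "g (X s) \<in> {1..J}" and lower: "\<And>j. j \<in> {1..J} \<Longrightarrow> e (X s) j \<ge> \<eta>"
      using X[OF s] g overlap by auto
    have "e (X s) (g (X s)) \<le> (\<Sum>j=1..J. e (X s) j)"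
      using gs lower eta by (intro member_le_sum) (auto intro: order.trans[of 0 \<eta>])
    then have "e (X s) (g (X s)) \<le> 1" using e_prob[OF X[OF s]] by simp
    moreover have "e (X s) (g (X s)) \<ge> \<eta>" using lower gs by blast
    ultimately show ?thesis using eta by (simp add: inv_prop_def frac_le)
  qed
  have mono: "strict_mono_on {0..N} ?C"
    using C_ord_strict_mono[OF sorting no_ties] inv_bounds by fastforce
  have C_bounds: "1 \<le> ?C s \<and> ?C s \<le> 1 / \<eta>" if "s \<in> {1..N}" for s
    using that inv_bounds[OF bij_betwE[OF bij, rule_format, OF that]] by (simp add: C_ord_def)
  have C_interval: "?C k \<in> {0..1 / \<eta>}" if "k \<le> N" for k
    using that C_bounds[of k] eta by (cases "k = 0") (auto simp: C_ord_def)
  have jump_points: "insert 0 (inv_prop e g X ` {1..N}) = ?C ` {0..N}"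
  proof -
    have "inv_prop e g X ` {1..N} = (\<lambda>s. inv_prop e g X (\<sigma> s)) ` {1..N}"
      using bij by (simp add: bij_betw_def image_image[symmetric])
    also have "\<dots> = ?C ` {1..N}" by (rule image_cong) (auto simp: C_ord_def)
    finally have "insert 0 (inv_prop e g X ` {1..N}) = ?C ` insert 0 {1..N}"
      by (simp only: image_insert) (simp add: C_ord_def)
    moreover have "insert 0 {1..N} = {0..N}" by auto
    ultimately show ?thesis by (simp only:)
  qed
  define c where "c = 2 * (\<Sum>s=1..N. phi_ord e g X D \<sigma> s)"
  have obj_C: "?F (?C k) = (?P (k + 1) + c) / (real N)\<^sup>2" if "k \<le> N" for k
    unfolding c_def using that strict_mono_on_less_eq[OF mono]
    by (intro trunc_objective_eq_Phi[OF sorting]) auto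
  have obj: "\<exists>k\<le>N. ?F \<tau> = ?F (?C k)" if nonneg: "0 \<le> \<tau>" for \<tau>
  proof -
    obtain k where k: "k \<le> N" and thr: "\<forall>s\<in>{1..N}. ?C s \<le> \<tau> \<longleftrightarrow> s \<le> k"
      using threshold_index_exists[OF mono nonneg] by blast
    have "?F \<tau> = (?P (k + 1) + c) / (real N)\<^sup>2"
      unfolding c_def using thr by (intro trunc_objective_eq_Phi[OF sorting k]) blast
    then show ?thesis using k obj_C[OF k] by auto
  qed

  have inj: "inj_on ?P {1..N + 1}" by (rule inj_on_Phi[OF bij non_integer])
  have m: "?m \<in> {1..N}" by (rule m_star_in_range[OF N]) (use C_bounds N in auto)
  \<comment> \<open>the index \<open>k\<close> whose successor minimizes \<open>Phi\<close>\<close>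
  obtain n where n: "n \<in> {1..N + 1}" and n_min: "\<And>t. t \<in> {1..N + 1} \<Longrightarrow> ?P n \<le> ?P t"
    using ex_is_arg_min_if_finite[of "{1..N + 1}" ?P] by (auto simp: is_arg_min_linorder)
  define k where "k = n - 1"
  have k: "k \<le> N" and nk: "n = k + 1" using n by (auto simp: k_def)
  have strict: "?P (k + 1) < ?P t" if "t \<in> {1..N + 1}" "t \<noteq> k + 1" for t
  proof -
    have "?P (k + 1) \<noteq> ?P t" using inj_onD[OF inj, of "k + 1" t] that n nk by blast
    then show ?thesis using n_min[OF that(1)] nk by simp
  qed
  have mk: "?m \<le> k + 1"
  proof (rule ccontr)
    assume "\<not> ?m \<le> k + 1"
    then have "?P ?m < ?P (k + 1)" using m by (intro Phi_m_star_less) auto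
    then show False using n_min[of ?m] m nk by auto
  qed

  have F_less: "?F (?C k) < ?F (?C l)" if "l \<le> N" "l \<noteq> k" for l
    using that strict[of "l + 1"] k N by (simp add: obj_C divide_strict_right_mono)
  have tau: "is_tau_hat N \<eta> e g X D \<tau> \<longleftrightarrow> \<tau> = ?C k" for \<tau>
  proof
    assume "is_tau_hat N \<eta> e g X D \<tau>"
    then obtain l where l: "l \<le> N" "\<tau> = ?C l" and "\<not> ?F (?C k) < ?F (?C l)"
      using C_interval[OF k] unfolding is_tau_hat_def jump_points is_arg_min_def by auto
    then show "\<tau> = ?C k" using F_less by blast
  next
    assume "\<tau> = ?C k"
    moreover have "?F (?C k) \<le> ?F x" if nonneg: "0 \<le> x" for x
    proof -
      obtain l where "l \<le> N" "?F x = ?F (?C l)" using obj[OF nonneg] by blast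
      then show ?thesis using F_less[of l] by (cases "l = k") auto
    qed
    ultimately show "is_tau_hat N \<eta> e g X D \<tau>"
      using k C_interval[OF k] unfolding is_tau_hat_def jump_points is_arg_min_linorder by auto
  qed
  then have ex1: "\<exists>!\<tau>. is_tau_hat N \<eta> e g X D \<tau>" and that_eq: "tau_hat N \<eta> e g X D = ?C k"
    by (simp_all add: tau_hat_def)

  have "indicator {0<..} ((MIN t \<in> {?m..N + 1} - {l + 1}. ?P t) - ?P (l + 1))
      = (of_bool (l = k) :: real)" if l: "l \<in> {?m - 1..N}" for l
  proof -
    have "(if l = N then ?m else N + 1) \<in> {?m..N + 1} - {l + 1}" using m by auto
    then have "{?m..N + 1} - {l + 1} \<noteq> {}" by (metis empty_iff)
    then have "indicator {0<..} ((MIN t \<in> {?m..N + 1} - {l + 1}. ?P t) - ?P (l + 1))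
        = (of_bool (l + 1 = k + 1) :: real)"
      using l m k mk strict by (intro indicator_strict_minimum) auto
    then show ?thesis by simp
  qed
  then have "(\<Sum>l = ?m - 1..N. ?C l *
        indicator {0<..} ((MIN t \<in> {?m..N + 1} - {l + 1}. ?P t) - ?P (l + 1)))
      = (\<Sum>l = ?m - 1..N. ?C l * of_bool (l = k))"
    by (intro sum.cong) auto
  also have "\<dots> = (\<Sum>l = ?m - 1..N. if l = k then ?C l else 0)"
    by (intro sum.cong) auto
  also have "\<dots> = ?C k" using k mk by simp
  finally show ?thesis using ex1 that_eq by simp
qed

end
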